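(* Let $f:\mathbb{C}\to\mathbb{C}$ be a polynomial of degree $d>1$ with Julia set $J$, and let $\Gamma=(\mathcal V,\mathcal E)$ be a box chain model of $f$ on $J$, with box Julia set $\mathcal B=\mathcal B(\Gamma)$. Suppose there exist a box metric $\Phi$ on $\mathcal V$ and a constant $L>1$ for which $\Gamma$ is box expansive. Then $f$ is hyperbolic. In particular, there exists a smooth function $\rho:\mathcal B\to\mathbb{R}^+$, which defines a riemannian metric on $T\mathcal B$ (by $\rho$ times euclidean, i.e. $|\mathbf v|_\rho=\rho(z)\,|\mathbf v|$ for $\mathbf v\in T_z\mathcal B$), such that for all $z\in\mathcal B$ and $\mathbf v\in T_z\mathcal B$, $$|D_zf(\mathbf v)|_\rho\ \ge\ L\,|\mathbf v|_\rho .$$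
   Context: The Julia set $J$ of a polynomial $f$ of degree $>1$ is the topological boundary of the set of points with bounded orbits. Hyperbolic: $f$ is hyperbolic if there exist a riemannian metric $\mu$ on some neighborhood $U$ of $J$ and an expansion constant $\lambda>1$ such that the derivative $D_zf$ at every point $z\in U$ satisfies $|D_zf(\mathbf v)|_\mu\ge\lambda|\mathbf v|_\mu$ for every $\mathbf v\in T_z\mathbb{C}$. Boxes: a closed box in $\mathbb{C}=\mathbb{R}^2$ is a product $[a,b]\times[c,d]$ of closed intervals. $\mathcal N(S,r)$ denotes the open $r$-neighborhood of $S$. Box chain model of $f$ on $J$: a directed graph $\Gamma=(\mathcal V,\mathcal E)$ whose vertex set $\mathcal V=\{B_k\}_{k=1}^N$ is a finite collection of closed boxes in $\mathbb{C}$ with disjoint interiors, whose union $\mathcal B=\mathcal B(\Gamma)=\bigcup_k B_k$ (the box Julia set) contains $J$, such that for some $\delta>0$ one has $\mathcal E\supset\{(k,j): f(B_k)\cap\mathcal N(B_j,\delta)\ne\emptyset\}$, and such that $\Gamma$ is strongly connected (for each pair of vertices there are paths in $\Gamma$ in both directions). Here $(k,j)\in\mathcal E$ means there is an edge from $B_k$ to $B_j$. Box metric: a family $\Phi=\{\varphi_k\}_{k=1}^N$ of positive constants (handicaps), one for each box, inducing the norms $|\mathbf v|_k:=\varphi_k|\mathbf v|$ for $\mathbf v\in T_zB_k$, $z\in B_k$, where $|\cdot|$ is the euclidean norm. Box expansive for the box metric $\Phi$ and the constant $L$: for all $(k,j)\in\mathcal E$, $z\in B_k$ and $\mathbf v\in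 T_zB_k$, $|D_zf(\mathbf v)|_j\ge L|\mathbf v|_k$.
   Formalization: The expansion inequality is required at those z in 𝓑 (and, in the definition of hyperbolic, those z in U) for which f(z) again lies in 𝓑 (resp. U), since the metric at f(z) is otherwise undefined. *)

theory Defs
  imports
    "HOL-Analysis.Analysis"
    "HOL-Computational_Algebra.Polynomial"
    "Graph_Theory.Digraph_Component"
begin

definition julia_set :: "complex poly \<Rightarrow> complex set" where
  "julia_set p = frontier {z. bounded (range (\<lambda>n. (poly p ^^ n) z))}"

text \<open>
  \<open>C_k n f W\<close>, for open \<open>W\<close>: \<open>f\<close> is \<open>n\<close> times differentiable on \<open>W\<close> in the sense of
  Frechet, with all iterated directional derivatives up to order \<open>n\<close> continuous. On an
  arbitrary set, smoothness means having a smooth extension to an open neighbourhood.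
\<close>

primrec C_k :: "nat \<Rightarrow> ('a::real_normed_vector \<Rightarrow> 'b::real_normed_vector) \<Rightarrow> 'a set \<Rightarrow> bool" where
  "C_k 0 f W \<longleftrightarrow> continuous_on W f"
| "C_k (Suc n) f W \<longleftrightarrow>
     (\<forall>x\<in>W. f differentiable (at x)) \<and> (\<forall>v. C_k n (\<lambda>x. frechet_derivative f (at x) v) W)"

definition smooth_on :: "'a::real_normed_vector set \<Rightarrow> ('a \<Rightarrow> 'b::real_normed_vector) \<Rightarrow> bool" where
  "smooth_on S f \<longleftrightarrow>
     (\<exists>W g. open W \<and> S \<subseteq> W \<and> (\<forall>n. C_k n g W) \<and> (\<forall>x\<in>S. g x = f x))"

text \<open>
  All tangent spaces of the plane are identified with \<^typ>\<open>complex\<close>, regarded as a real vector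
  space: \<open>g z v w\<close> is the inner product of \<open>v\<close> and \<open>w\<close> at the base point \<open>z\<close>, and a family of
  norms \<open>\<nu>\<close> assigns to \<open>v\<close> at \<open>z\<close> the length \<open>\<nu> z v\<close>.
\<close>

definition riemannian_metric_on ::
    "complex set \<Rightarrow> (complex \<Rightarrow> complex \<Rightarrow> complex \<Rightarrow> real) \<Rightarrow> bool" where
  "riemannian_metric_on S g \<longleftrightarrow>
     (\<forall>z\<in>S. bilinear (g z) \<and> (\<forall>v w. g z v w = g z w v) \<and> (\<forall>v. v \<noteq> 0 \<longrightarrow> g z v v > 0)) \<and>
     (\<forall>v w. smooth_on S (\<lambda>z. g z v w))"

definition riemannian_norm ::
    "(complex \<Rightarrow> complex \<Rightarrow> complex \<Rightarrow> real) \<Rightarrow> complex \<Rightarrow> complex \<Rightarrow> real" where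
  "riemannian_norm g z v = sqrt (g z v v)"

definition conformal_metric :: "(complex \<Rightarrow> real) \<Rightarrow> complex \<Rightarrow> complex \<Rightarrow> complex \<Rightarrow> real" where
  "conformal_metric \<rho> z v w = (\<rho> z)\<^sup>2 * (v \<bullet> w)"

lemma riemannian_norm_conformal_metric:
  assumes "\<rho> z \<ge> 0"
  shows "riemannian_norm (conformal_metric \<rho>) z v = \<rho> z * norm v"
  using assms
  by (simp add: riemannian_norm_def conformal_metric_def real_sqrt_mult norm_eq_sqrt_inner)

text \<open>
  The vector \<open>D\<^sub>z f(v)\<close> is tangent at \<open>f z\<close>, so its length is defined only if \<open>f z\<close> lies in the
  set \<open>S\<close> carrying the norms; neither a neighbourhood of the Julia set nor a union of boxes
  covering it need be forward invariant.
\<close>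

definition expands_on ::
    "complex set \<Rightarrow> (complex \<Rightarrow> complex \<Rightarrow> real) \<Rightarrow> (complex \<Rightarrow> complex) \<Rightarrow> real \<Rightarrow> bool" where
  "expands_on S \<nu> f c \<longleftrightarrow>
     (\<forall>z\<in>S. f z \<in> S \<longrightarrow> (\<forall>v. \<nu> (f z) (frechet_derivative f (at z) v) \<ge> c * \<nu> z v))"

definition hyperbolic :: "complex poly \<Rightarrow> bool" where
  "hyperbolic p \<longleftrightarrow>
     (\<exists>U g c. open U \<and> julia_set p \<subseteq> U \<and> riemannian_metric_on U g \<and> c > 1 \<and>
        expands_on U (riemannian_norm g) (poly p) c)"

definition closed_box :: "complex set \<Rightarrow> bool" where
  "closed_box A \<longleftrightarrow> (\<exists>a b c d. a \<le> b \<and> c \<le> d \<and> A = cbox (Complex a c) (Complex b d))"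

definition nbhd :: "complex set \<Rightarrow> real \<Rightarrow> complex set" where
  "nbhd S r = (\<Union>x\<in>S. ball x r)"

definition box_julia_set :: "complex set pair_pre_digraph \<Rightarrow> complex set" where
  "box_julia_set \<Gamma> = \<Union>(pverts \<Gamma>)"

text \<open>The vertices of the graph are the boxes themselves.\<close>

definition box_chain_model :: "complex poly \<Rightarrow> complex set pair_pre_digraph \<Rightarrow> bool" where
  "box_chain_model p \<Gamma> \<longleftrightarrow>
     pair_fin_digraph \<Gamma> \<and>
     (\<forall>A\<in>pverts \<Gamma>. closed_box A) \<and>
     (\<forall>A\<in>pverts \<Gamma>. \<forall>B\<in>pverts \<Gamma>. A \<noteq> B \<longrightarrow> interior A \<inter> interior B = {}) \<and>
     julia_set p \<subseteq> box_julia_set \<Gamma> \<and>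
     (\<exists>\<delta>>0. \<forall>A\<in>pverts \<Gamma>. \<forall>B\<in>pverts \<Gamma>.
        poly p ` A \<inter> nbhd B \<delta> \<noteq> {} \<longrightarrow> (A, B) \<in> parcs \<Gamma>) \<and>
     strongly_connected (with_proj \<Gamma>)"

definition box_metric :: "complex set pair_pre_digraph \<Rightarrow> (complex set \<Rightarrow> real) \<Rightarrow> bool" where
  "box_metric \<Gamma> \<phi> \<longleftrightarrow> (\<forall>A\<in>pverts \<Gamma>. \<phi> A > 0)"

definition box_norm :: "(complex set \<Rightarrow> real) \<Rightarrow> complex set \<Rightarrow> complex \<Rightarrow> real" where
  "box_norm \<phi> A v = \<phi> A * norm v"

definition box_expansive ::
    "complex poly \<Rightarrow> complex set pair_pre_digraph \<Rightarrow> (complex set \<Rightarrow> real) \<Rightarrow> real \<Rightarrow> bool" where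
  "box_expansive p \<Gamma> \<phi> L \<longleftrightarrow>
     (\<forall>(A, B)\<in>parcs \<Gamma>. \<forall>z\<in>A. \<forall>v.
        box_norm \<phi> B (frechet_derivative (poly p) (at z) v) \<ge> L * box_norm \<phi> A v)"

end

(* A smooth rho is built such that rho <= phi A near each box A, while at every point z near the
   union of the boxes rho z >= phi B for some box B at distance less than delta / 2 from z. If z lies in A
   and B is such a box for f z, then (A, B) is an edge, so
   rho (f z) |f' z| >= phi B |f' z| >= L phi A >= L rho z. On a small neighbourhood of the boxes
   uniform continuity of f and f' preserves this with any constant below L. *)

theory Submission
  imports Defs
begin

subsection \<open>Smooth functions\<close>

text \<open>A derivative at a point depends only on the germ there. As \<open>W\<close> is open,
  \<open>f\<close> and \<open>g\<close> agree near each of its points, and the induction passes to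
  directional derivatives.\<close>

lemma C_k_cong:
  assumes "open W" "C_k n f W" "\<And>x. x \<in> W \<Longrightarrow> f x = g x"
  shows "C_k n g W"
  using assms(2,3)
proof (induction n arbitrary: f g)
  case 0
  then show ?case by (auto cong: continuous_on_cong)
next
  case (Suc n)
  have der: "(g has_derivative frechet_derivative f (at x)) (at x)" if "x \<in> W" for x
    using Suc.prems that \<open>open W\<close> frechet_derivative_works
    by (auto intro!: has_derivative_transform_within_open[of f _ x UNIV W g])
  have "frechet_derivative g (at x) = frechet_derivative f (at x)" if "x \<in> W" for x
    using frechet_derivative_at[OF der[OF that]] by simp
  then have "C_k n (\<lambda>x. frechet_derivative g (at x) v) W" for v
    using Suc.prems(1) by (force intro: Suc.IH[of "\<lambda>x. frechet_derivative f (at x) v"])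
  then show ?case
    using der by (auto simp: differentiable_def)
qed

text \<open>By uniqueness of derivatives, any explicit formula \<open>f'\<close> may stand in for
  \<open>frechet_derivative\<close>. The closure rules below all differentiate through this
  rule.\<close>

lemma C_k_SucI:
  assumes "open W" "\<And>x. x \<in> W \<Longrightarrow> (f has_derivative f' x) (at x)"
    and "\<And>v. C_k n (\<lambda>x. f' x v) W"
  shows "C_k (Suc n) f W"
proof -
  have "C_k n (\<lambda>x. frechet_derivative f (at x) v) W" for v
    by (rule C_k_cong[OF assms(1) assms(3)[of v]]) (simp add: frechet_derivative_at[OF assms(2)])
  then show ?thesis
    using assms(2) by (auto simp: differentiable_def)
qed

lemma C_k_Suc_has_derivative:
  assumes "C_k (Suc n) f W" "x \<in> W"
  shows "(f has_derivative frechet_derivative f (at x)) (at x)"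
  using assms frechet_derivative_works by auto

text \<open>The successor clause of \<open>C_k\<close> does not mention continuity of
  \<open>f\<close>; differentiability supplies it. The product and chain rules need this lemma for
  their undifferentiated factors.\<close>

lemma C_k_Suc_imp: "C_k (Suc n) f W \<Longrightarrow> C_k n f W"
proof (induction n arbitrary: f)
  case 0
  then show ?case
    by (auto intro!: differentiable_imp_continuous_on
        simp: differentiable_on_def differentiable_at_withinI)
next
  case (Suc n)
  from Suc.prems have "\<forall>x\<in>W. f differentiable (at x)"
    and "C_k (Suc n) (\<lambda>x. frechet_derivative f (at x) v) W" for v
    by simp_all
  with Suc.IH show ?case by simp
qed

lemma C_k_const: "C_k n (\<lambda>x. c) W"
  by (induction n arbitrary: c) (auto simp: frechet_derivative_const)

lemma C_k_bounded_linear: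
  assumes "bounded_linear f" "open W"
  shows "C_k n f W"
proof (cases n)
  case 0
  then show ?thesis using assms by (simp add: linear_continuous_on)
next
  case (Suc m)
  show ?thesis
    unfolding Suc
    by (rule C_k_SucI[OF assms(2) bounded_linear_imp_has_derivative[OF assms(1)] C_k_const])
qed

section \<open>Closure of \<open>C_k\<close> under algebraic operations and composition\<close>

lemma C_k_add:
  assumes "open W" "C_k n f W" "C_k n g W"
  shows "C_k n (\<lambda>x. f x + g x) W"
  using assms(2,3)
proof (induction n arbitrary: f g)
  case 0
  then show ?case by (auto intro: continuous_on_add)
next
  case (Suc n)
  show ?case
  proof (rule C_k_SucI[OF assms(1)])
    fix x assume "x \<in> W"
    then show "((\<lambda>x. f x + g x) has_derivative
        (\<lambda>v. frechet_derivative f (at x) v + frechet_derivative g (at x) v)) (at x)"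
      using Suc.prems by (intro has_derivative_add C_k_Suc_has_derivative)
  qed (use Suc in auto)
qed

lemma C_k_mult:
  fixes f g :: "'a::real_normed_vector \<Rightarrow> 'b::real_normed_algebra"
  assumes "open W" "C_k n f W" "C_k n g W"
  shows "C_k n (\<lambda>x. f x * g x) W"
  using assms(2,3)
proof (induction n arbitrary: f g)
  case 0
  then show ?case by (auto intro: continuous_on_mult)
next
  case (Suc n)
  show ?case
  proof (rule C_k_SucI[OF assms(1)])
    fix x assume "x \<in> W"
    then show "((\<lambda>x. f x * g x) has_derivative
        (\<lambda>v. f x * frechet_derivative g (at x) v + frechet_derivative f (at x) v * g x)) (at x)"
      using Suc.prems by (intro has_derivative_mult C_k_Suc_has_derivative)
  next
    fix v
    have "C_k n f W" "C_k n g W"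
      using Suc.prems C_k_Suc_imp by blast+
    then show "C_k n (\<lambda>x. f x * frechet_derivative g (at x) v
        + frechet_derivative f (at x) v * g x) W"
      using Suc by (intro C_k_add[OF assms(1)] Suc.IH) auto
  qed
qed

lemma C_k_diff:
  fixes f g :: "'a::real_normed_vector \<Rightarrow> 'b::real_normed_algebra_1"
  assumes "open W" "C_k n f W" "C_k n g W"
  shows "C_k n (\<lambda>x. f x - g x) W"
  using C_k_add[OF assms(1,2) C_k_mult[OF assms(1) C_k_const[of n "-1"] assms(3)]] by simp

lemma C_k_prod:
  fixes f :: "'i \<Rightarrow> 'a::real_normed_vector \<Rightarrow> 'b::real_normed_field"
  assumes "open W" "\<And>i. i \<in> I \<Longrightarrow> C_k n (f i) W"
  shows "C_k n (\<lambda>x. \<Prod>i\<in>I. f i x) W"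
  using assms(2)
  by (induction I rule: infinite_finite_induct) (auto intro: C_k_const C_k_mult[OF assms(1)])

text \<open>The derivative of 1/f involves only 1/f and the derivative of f, so the induction
  hypothesis about 1/f itself closes the induction.\<close>

lemma C_k_inverse:
  fixes f :: "'a::real_normed_vector \<Rightarrow> 'b::real_normed_field"
  assumes "open W" "C_k n f W" "\<And>x. x \<in> W \<Longrightarrow> f x \<noteq> 0"
  shows "C_k n (\<lambda>x. inverse (f x)) W"
  using assms(2)
proof (induction n)
  case 0
  then show ?case using assms(3) by (auto intro: continuous_on_inverse)
next
  case (Suc n)
  show ?case
  proof (rule C_k_SucI[OF assms(1)])
    fix x assume "x \<in> W"
    then show "((\<lambda>x. inverse (f x)) has_derivative
        (\<lambda>v. (-1) * (inverse (f x) * frechet_derivative f (at x) v * inverse (f x)))) (at x)"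
      using Deriv.has_derivative_inverse[OF assms(3) C_k_Suc_has_derivative[OF Suc.prems]] by simp
  next
    fix v
    have "C_k n (\<lambda>x. inverse (f x)) W"
      using Suc C_k_Suc_imp by blast
    then show "C_k n (\<lambda>x. (-1) * (inverse (f x) * frechet_derivative f (at x) v * inverse (f x))) W"
      using Suc.prems by (intro C_k_mult[OF assms(1)] C_k_const) auto
  qed
qed

lemma C_k_compose_real:
  fixes h :: "real \<Rightarrow> real"
  assumes "open W" "C_k n h UNIV" "C_k n g W"
  shows "C_k n (\<lambda>x. h (g x)) W"
  using assms(2,3)
proof (induction n arbitrary: h)
  case 0
  then show ?case by (auto intro: continuous_on_compose2[of UNIV h])
next
  case (Suc n)
  show ?case
  proof (rule C_k_SucI[OF assms(1)])
    fix x assume "x \<in> W"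
    let ?D = "frechet_derivative h (at (g x))"
    have h: "(h has_derivative ?D) (at (g x))"
      using Suc.prems by (intro C_k_Suc_has_derivative) auto
    have "((\<lambda>x. h (g x)) has_derivative (\<lambda>v. ?D (frechet_derivative g (at x) v))) (at x)"
      using has_derivative_compose[OF C_k_Suc_has_derivative[OF Suc.prems(2) \<open>x \<in> W\<close>] h] .
    \<comment> \<open>A linear map on the reals is multiplication by its value at 1. This turns the
      chain rule into a product, to which \<open>C_k_mult\<close> and the induction hypothesis for
      h' apply.\<close>
    moreover have "?D t = t * ?D 1" for t
      using linear_cmul[OF has_derivative_linear[OF h], of t 1] by simp
    then have "(\<lambda>v. ?D (frechet_derivative g (at x) v)) = (\<lambda>v. frechet_derivative g (at x) v * ?D 1)"
      by (intro ext)
    ultimately show "((\<lambda>x. h (g x)) has_derivative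
        (\<lambda>v. frechet_derivative g (at x) v * ?D 1)) (at x)"
      by simp
  next
    fix v
    have "C_k n g W"
      using Suc.prems C_k_Suc_imp by blast
    then show "C_k n (\<lambda>x. frechet_derivative g (at x) v * frechet_derivative h (at (g x)) 1) W"
      using Suc.prems Suc.IH[of "\<lambda>t. frechet_derivative h (at t) 1"]
      by (intro C_k_mult[OF assms(1)]) auto
  qed
qed

text \<open>The square removes the singularity of the norm at \<open>c\<close>; the derivative in a
  fixed direction is affine in \<open>x\<close>.\<close>

lemma C_k_norm_diff_square:
  fixes c :: "'a::real_inner"
  assumes "open W"
  shows "C_k n (\<lambda>x. (norm (x - c))\<^sup>2) W"
proof (cases n)
  case 0
  then show ?thesis by (auto intro!: continuous_intros)
next
  case (Suc m)
  have "C_k (Suc m) (\<lambda>x. (x - c) \<bullet> (x - c)) W"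
  proof (rule C_k_SucI[OF assms])
    show "((\<lambda>x. (x - c) \<bullet> (x - c)) has_derivative (\<lambda>v. (2 *\<^sub>R v) \<bullet> x - 2 * (c \<bullet> v))) (at x)" for x
      by (auto intro!: derivative_eq_intros simp: inner_diff inner_commute)
    show "C_k m (\<lambda>x. (2 *\<^sub>R v) \<bullet> x - 2 * (c \<bullet> v)) W" for v
      by (intro C_k_diff[OF assms] C_k_const C_k_bounded_linear[OF bounded_linear_inner_right assms])
  qed
  then show ?thesis
    by (simp add: Suc power2_norm_eq_inner del: C_k.simps)
qed

lemma smooth_onI:
  assumes "\<And>n. C_k n f UNIV"
  shows "smooth_on S f"
  using assms unfolding smooth_on_def by (intro exI[of _ UNIV] exI[of _ f]) auto

subsection \<open>Bump functions\<close>

text \<open>The functions \<open>q (1/t) exp (- 1/t)\<close> with polynomial \<open>q\<close> are closed under differentiation,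
  which makes the induction for smoothness at \<open>0\<close> immediate.\<close>

definition flat_exp :: "real poly \<Rightarrow> real \<Rightarrow> real" where
  "flat_exp q t = (if t > 0 then poly q (inverse t) * exp (- inverse t) else 0)"

lemma poly_times_exp_minus_tendsto_0:
  fixes q :: "real poly"
  shows "((\<lambda>s. poly q s * exp (- s)) \<longlongrightarrow> 0) at_top"
proof -
  have "((\<lambda>s. \<Sum>i\<le>degree q. coeff q i * (s ^ i / exp s)) \<longlongrightarrow> (\<Sum>i\<le>degree q. coeff q i * 0)) at_top"
    by (intro tendsto_sum tendsto_mult tendsto_const tendsto_power_div_exp_0)
  then show ?thesis
    by (simp add: poly_altdef sum_distrib_right exp_minus divide_inverse mult.assoc)
qed

text \<open>From the right, s = 1/t reduces the limit to exponential decay beating polynomial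
  growth; from the left the function vanishes.\<close>

lemma flat_exp_tendsto_0: "(flat_exp q \<longlongrightarrow> 0) (at 0)"
proof -
  have "((\<lambda>t. poly q (inverse t) * exp (- inverse t)) \<longlongrightarrow> 0) (at_right 0)"
    using filterlim_compose[OF poly_times_exp_minus_tendsto_0 filterlim_inverse_at_top_right] .
  then have "(flat_exp q \<longlongrightarrow> 0) (at_right 0)"
    by (rule Lim_transform_eventually)
      (auto simp: flat_exp_def eventually_at_filter)
  moreover have "(flat_exp q \<longlongrightarrow> 0) (at_left 0)"
    by (rule Lim_transform_eventually[OF tendsto_const])
      (auto simp: flat_exp_def eventually_at_filter)
  ultimately show ?thesis
    by (simp add: filterlim_split_at)
qed

text \<open>For t > 0, differentiating q(1/t) exp(-1/t) produces the factor (q - q')(1/t) / t^2; the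
  polynomial \<open>[:0, 0, 1:]\<close> encodes 1/t^2.\<close>

lemma flat_exp_has_derivative:
  "(flat_exp q has_real_derivative flat_exp ((q - pderiv q) * [:0, 0, 1:]) t) (at t)"
proof -
  consider "t < 0" | "t = 0" | "t > 0" by linarith
  then show ?thesis
  proof cases
    case 1
    have "((\<lambda>_. 0) has_real_derivative 0) (at t)" by simp
    then have "(flat_exp q has_real_derivative 0) (at t)"
      by (rule has_field_derivative_transform_within_open[of _ _ _ "{..<0}"])
        (use 1 in \<open>auto simp: flat_exp_def\<close>)
    then show ?thesis using 1 by (simp add: flat_exp_def)
  next
    case 2
    \<comment> \<open>The difference quotient at 0 lies in the same family, with q multiplied by its
      variable, so it tends to 0.\<close>
    have "flat_exp q (0 + h) - flat_exp q 0 = h * flat_exp (pCons 0 q) h" for h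
      by (simp add: flat_exp_def field_simps)
    then have "(\<lambda>h. (flat_exp q (0 + h) - flat_exp q 0) / h) \<midarrow>0\<rightarrow> 0"
      using Lim_transform_eventually[OF flat_exp_tendsto_0[of "pCons 0 q"]]
      by (simp add: eventually_at_filter)
    then show ?thesis
      unfolding 2 DERIV_def by (simp add: flat_exp_def)
  next
    case 3
    have "((\<lambda>t. poly q (inverse t) * exp (- inverse t)) has_real_derivative
        flat_exp ((q - pderiv q) * [:0, 0, 1:]) t) (at t)"
      using 3 by (auto intro!: derivative_eq_intros simp: flat_exp_def algebra_simps power2_eq_square)
    then show ?thesis
      by (rule has_field_derivative_transform_within_open[of _ _ _ "{0<..}"])
        (use 3 in \<open>auto simp: flat_exp_def\<close>)
  qed
qed

lemma C_k_flat_exp: "C_k n (flat_exp q) UNIV"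
proof (induction n arbitrary: q)
  case 0
  then show ?case
    using DERIV_isCont[OF flat_exp_has_derivative] by (simp add: continuous_on_eq_continuous_at)
next
  case (Suc n)
  show ?case
  proof (rule C_k_SucI)
    show "(flat_exp q has_derivative
        (\<lambda>v. flat_exp ((q - pderiv q) * [:0, 0, 1:]) t * v)) (at t)" for t
      using flat_exp_has_derivative by (rule has_field_derivative_imp_has_derivative)
  qed (auto intro!: C_k_mult C_k_const Suc)
qed

section \<open>Smooth steps and cut-off functions\<close>

lemma smooth_step:
  fixes a b :: real
  assumes "a < b"
  obtains s :: "real \<Rightarrow> real" where "\<And>n. C_k n s UNIV" "\<And>t. 0 \<le> s t" "\<And>t. s t \<le> 1"
    "\<And>t. t \<le> a \<Longrightarrow> s t = 1" "\<And>t. b \<le> t \<Longrightarrow> s t = 0"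
proof -
  define u v where "u t = flat_exp 1 (b - t)" and "v t = flat_exp 1 (t - a)" for t
  have nonneg: "u t \<ge> 0" "v t \<ge> 0" for t
    by (simp_all add: u_def v_def flat_exp_def)
  \<comment> \<open>Since a < b, every t satisfies t < b or t > a, so one of the two summands is
    positive.\<close>
  have pos: "u t + v t > 0" for t
    using assms by (auto simp: u_def v_def flat_exp_def add_pos_nonneg)
  have smooth: "C_k n u UNIV" "C_k n v UNIV" for n
    unfolding u_def v_def
    by (rule C_k_compose_real[OF open_UNIV C_k_flat_exp],
        intro C_k_diff C_k_const C_k_bounded_linear open_UNIV bounded_linear_ident)+
  show thesis
  proof
    show "C_k n (\<lambda>t. u t * inverse (u t + v t)) UNIV" for n
      using pos by (intro C_k_mult C_k_inverse C_k_add smooth) (auto simp: less_imp_neq[symmetric])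
    show "0 \<le> u t * inverse (u t + v t)" "u t * inverse (u t + v t) \<le> 1" for t
      using nonneg[of t] pos[of t] by (auto simp: field_simps)
    show "u t * inverse (u t + v t) = 1" if "t \<le> a" for t
      using that pos[of t] by (simp add: v_def flat_exp_def)
    show "u t * inverse (u t + v t) = 0" if "b \<le> t" for t
      using that by (simp add: u_def flat_exp_def)
  qed
qed

lemma smooth_bump_ball:
  fixes c :: "'a::real_inner"
  assumes "0 < a" "a < b"
  obtains \<psi> :: "'a \<Rightarrow> real" where "\<And>n. C_k n \<psi> UNIV" "\<And>x. 0 \<le> \<psi> x" "\<And>x. \<psi> x \<le> 1"
    "\<And>x. x \<in> ball c a \<Longrightarrow> \<psi> x = 1" "\<And>x. x \<notin> ball c b \<Longrightarrow> \<psi> x = 0"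
proof -
  have "a\<^sup>2 < b\<^sup>2"
    using assms by (simp add: power_strict_mono)
  from smooth_step[OF this] obtain s :: "real \<Rightarrow> real" where s: "\<And>n. C_k n s UNIV"
    "\<And>t. 0 \<le> s t" "\<And>t. s t \<le> 1" "\<And>t. t \<le> a\<^sup>2 \<Longrightarrow> s t = 1" "\<And>t. b\<^sup>2 \<le> t \<Longrightarrow> s t = 0"
    by metis
  show thesis
  proof
    show "C_k n (\<lambda>x. s ((norm (x - c))\<^sup>2)) UNIV" for n
      by (rule C_k_compose_real[OF open_UNIV s(1) C_k_norm_diff_square[OF open_UNIV]])
    show "s ((norm (x - c))\<^sup>2) = 1" if "x \<in> ball c a" for x
      using that assms by (intro s power_mono) (auto simp: dist_norm norm_minus_commute)
    show "s ((norm (x - c))\<^sup>2) = 0" if "x \<notin> ball c b" for x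
      using that assms by (intro s power_mono) (auto simp: dist_norm norm_minus_commute)
  qed (use s in auto)
qed

text \<open>Finitely many ball bumps are merged by 1 - prod (1 - \<psi>): the value is 1 where some
  bump is 1, 0 where all vanish, and never leaves [0, 1]. A point within r/4 of \<open>K\<close> is
  within r/2 of a centre of the r/4-cover, hence the plateau radius r/2.\<close>

lemma smooth_bump_compact:
  fixes K :: "'a::real_inner set"
  assumes "compact K" "0 < r"
  obtains \<beta> :: "'a \<Rightarrow> real" where "\<And>n. C_k n \<beta> UNIV" "\<And>x. 0 \<le> \<beta> x" "\<And>x. \<beta> x \<le> 1"
    "\<And>x. x \<in> (\<Union>y\<in>K. ball y (r / 4)) \<Longrightarrow> \<beta> x = 1"
    "\<And>x. x \<notin> (\<Union>y\<in>K. ball y r) \<Longrightarrow> \<beta> x = 0"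
proof -
  obtain F where F: "finite F" "F \<subseteq> K" "K \<subseteq> (\<Union>c\<in>F. ball c (r / 4))"
    by (rule compactE_image[OF assms(1), of K "\<lambda>c. ball c (r / 4)"]) (use assms(2) in auto)
  have "\<exists>\<psi> :: 'a \<Rightarrow> real. (\<forall>n. C_k n \<psi> UNIV) \<and> (\<forall>x. 0 \<le> \<psi> x \<and> \<psi> x \<le> 1) \<and>
    (\<forall>x\<in>ball c (r / 2). \<psi> x = 1) \<and> (\<forall>x. x \<notin> ball c r \<longrightarrow> \<psi> x = 0)" for c
    using smooth_bump_ball[of "r / 2" r c] assms(2) by (metis field_sum_of_halves half_gt_zero less_add_same_cancel1)
  then obtain \<psi> :: "'a \<Rightarrow> 'a \<Rightarrow> real" where \<psi>: "\<And>c n. C_k n (\<psi> c) UNIV"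
    "\<And>c x. 0 \<le> \<psi> c x" "\<And>c x. \<psi> c x \<le> 1" "\<And>c x. x \<in> ball c (r / 2) \<Longrightarrow> \<psi> c x = 1"
    "\<And>c x. x \<notin> ball c r \<Longrightarrow> \<psi> c x = 0"
    by metis
  show thesis
  proof
    show "C_k n (\<lambda>x. 1 - (\<Prod>c\<in>F. 1 - \<psi> c x)) UNIV" for n
      by (intro C_k_diff C_k_const C_k_prod \<psi> open_UNIV)
    show "0 \<le> 1 - (\<Prod>c\<in>F. 1 - \<psi> c x)" for x
      using \<psi> by (simp add: prod_le_1)
    show "1 - (\<Prod>c\<in>F. 1 - \<psi> c x) \<le> 1" for x
      using \<psi> by (simp add: prod_nonneg)
    show "1 - (\<Prod>c\<in>F. 1 - \<psi> c x) = 1" if "x \<in> (\<Union>y\<in>K. ball y (r / 4))" for x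
    proof -
      obtain y where y: "y \<in> K" "dist y x < r / 4"
        using \<open>x \<in> _\<close> by auto
      then obtain c where c: "c \<in> F" "dist c y < r / 4"
        using F(3) by auto
      with y have "x \<in> ball c (r / 2)"
        using dist_triangle[of c x y] by simp
      then show ?thesis
        using c(1) F(1) \<psi>(4) by (auto simp: prod_zero_iff intro!: bexI[of _ c])
    qed
    show "1 - (\<Prod>c\<in>F. 1 - \<psi> c x) = 0" if "x \<notin> (\<Union>y\<in>K. ball y r)" for x
    proof -
      have "\<psi> c x = 0" if "c \<in> F" for c
        using \<psi>(5) F(2) that \<open>x \<notin> _\<close> by blast
      then show ?thesis by simp
    qed
  qed
qed

subsection \<open>Interpolating the handicaps\<close>

text \<open>The sets are inserted in order of decreasing handicap, so that each correction
  \<open>\<beta> (\<rho> - \<phi> A)\<close> is nonnegative and no earlier upper bound is destroyed.\<close>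

lemma smooth_interpolation:
  fixes \<phi> :: "'a::real_inner set \<Rightarrow> real"
  assumes "finite V" "\<And>A. A \<in> V \<Longrightarrow> compact A" "\<And>A. A \<in> V \<Longrightarrow> \<phi> A \<le> M" "0 < r"
  shows "\<exists>\<rho> :: 'a \<Rightarrow> real. (\<forall>n. C_k n \<rho> UNIV) \<and>
    (\<forall>A\<in>V. \<forall>x\<in>\<Union>y\<in>A. ball y (r / 4). \<rho> x \<le> \<phi> A) \<and>
    (\<forall>x. M \<le> \<rho> x \<or> (\<exists>A\<in>V. x \<in> (\<Union>y\<in>A. ball y r) \<and> \<phi> A \<le> \<rho> x))"
  using assms(1-3)
\<comment> \<open>The rule inserts an element of greatest rank, so the minus sign makes the new
  \<open>A\<close> one of least handicap.\<close>
proof (induction V rule: finite_ranking_induct[where f = "\<lambda>A. - \<phi> A"])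
  case empty
  show ?case
    by (rule exI[of _ "\<lambda>_. M"]) (auto intro: C_k_const)
next
  case (insert A V)
  then obtain \<rho> :: "'a \<Rightarrow> real" where \<rho>: "\<And>n. C_k n \<rho> UNIV"
    "\<And>B x. B \<in> V \<Longrightarrow> x \<in> (\<Union>y\<in>B. ball y (r / 4)) \<Longrightarrow> \<rho> x \<le> \<phi> B"
    "\<And>x. M \<le> \<rho> x \<or> (\<exists>B\<in>V. x \<in> (\<Union>y\<in>B. ball y r) \<and> \<phi> B \<le> \<rho> x)"
    by (metis insert_iff)
  obtain \<beta> :: "'a \<Rightarrow> real" where \<beta>: "\<And>n. C_k n \<beta> UNIV" "\<And>x. 0 \<le> \<beta> x" "\<And>x. \<beta> x \<le> 1"
    "\<And>x. x \<in> (\<Union>y\<in>A. ball y (r / 4)) \<Longrightarrow> \<beta> x = 1" "\<And>x. x \<notin> (\<Union>y\<in>A. ball y r) \<Longrightarrow> \<beta> x = 0"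
    using smooth_bump_compact[of A r] insert.prems assms(4) by (metis insertI1)
  \<comment> \<open>This is the convex combination of \<rho> and the constant \<phi> A with weight
    \<beta>: equal to \<phi> A close to \<open>A\<close> and unchanged away from it.\<close>
  define \<sigma> where "\<sigma> x = \<rho> x - \<beta> x * (\<rho> x - \<phi> A)" for x
  have above: "\<phi> A \<le> \<rho> x" for x
    using \<rho>(3)[of x] insert.hyps insert.prems(2)[of A] by fastforce
  have le: "\<sigma> x \<le> \<rho> x" for x
    using above[of x] \<beta>(2)[of x] by (simp add: \<sigma>_def)
  have ge: "\<phi> A \<le> \<sigma> x" for x
    using mult_right_mono[OF \<beta>(3)[of x], of "\<rho> x - \<phi> A"] above[of x] by (simp add: \<sigma>_def)
  have "C_k n \<sigma> UNIV" for n
    unfolding \<sigma>_def by (intro C_k_diff C_k_mult C_k_const \<rho> \<beta> open_UNIV)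
  moreover have "\<sigma> x \<le> \<phi> B" if "B \<in> insert A V" "x \<in> (\<Union>y\<in>B. ball y (r / 4))" for B x
  proof (cases "B = A")
    case True
    with that \<beta>(4)[of x] show ?thesis by (simp add: \<sigma>_def)
  next
    case False
    with that \<rho>(2)[of B x] le[of x] show ?thesis by simp
  qed
  moreover have "M \<le> \<sigma> x \<or> (\<exists>B\<in>insert A V. x \<in> (\<Union>y\<in>B. ball y r) \<and> \<phi> B \<le> \<sigma> x)" for x
  proof (cases "x \<in> (\<Union>y\<in>A. ball y r)")
    case True
    with ge show ?thesis by blast
  next
    case False
    with \<beta>(5) have "\<sigma> x = \<rho> x" by (simp add: \<sigma>_def)
    with \<rho>(3)[of x] show ?thesis by auto
  qed
  ultimately show ?case by blast
qed

subsection \<open>Box expansion implies hyperbolicity\<close>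

lemma frechet_derivative_poly:
  fixes p :: "complex poly"
  shows "frechet_derivative (poly p) (at z) = (\<lambda>v. poly (pderiv p) z * v)"
  using frechet_derivative_at[OF has_field_derivative_imp_has_derivative[OF poly_DERIV]] by metis

lemma riemannian_metric_on_conformal:
  assumes "\<And>n. C_k n \<rho> UNIV" "\<And>z. z \<in> S \<Longrightarrow> \<rho> z > 0"
  shows "riemannian_metric_on S (conformal_metric \<rho>)"
proof -
  have "bilinear (conformal_metric \<rho> z)" for z
    unfolding bilinear_def conformal_metric_def
    by (auto intro!: linearI simp: inner_add algebra_simps)
  moreover have "smooth_on S (\<lambda>z. conformal_metric \<rho> z v w)" for v w
    unfolding conformal_metric_def power2_eq_square
    by (intro smooth_onI C_k_mult C_k_const assms open_UNIV)
  moreover have "0 < conformal_metric \<rho> z v v" if "z \<in> S" "v \<noteq> 0" for z v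
    unfolding conformal_metric_def using assms(2)[OF that(1)] that(2) by (intro mult_pos_pos) auto
  moreover have "conformal_metric \<rho> z v w = conformal_metric \<rho> z w v" for z v w
    by (simp add: conformal_metric_def inner_commute)
  ultimately show ?thesis
    unfolding riemannian_metric_on_def by blast
qed

theorem theorem1p4:
  fixes p :: "complex poly"
    and \<Gamma> :: "complex set pair_pre_digraph"
    and \<phi> :: "complex set \<Rightarrow> real"
    and L :: real
  assumes "degree p > 1"
    and "box_chain_model p \<Gamma>"
    and "box_metric \<Gamma> \<phi>"
    and "L > 1"
    and "box_expansive p \<Gamma> \<phi> L"
  shows "hyperbolic p \<and>
    (\<exists>\<rho> :: complex \<Rightarrow> real.
       smooth_on (box_julia_set \<Gamma>) \<rho> \<and>
       (\<forall>z\<in>box_julia_set \<Gamma>. \<rho> z > 0) \<and>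
       riemannian_metric_on (box_julia_set \<Gamma>) (conformal_metric \<rho>) \<and>
       expands_on (box_julia_set \<Gamma>) (\<lambda>z v. \<rho> z * norm v) (poly p) L)"
proof -
  define V where "V = pverts \<Gamma>"
  define X where "X = box_julia_set \<Gamma>"
  define D where "D z = norm (poly (pderiv p) z)" for z
  interpret pair_fin_digraph \<Gamma>
    using assms(2) by (simp add: box_chain_model_def)
  have "finite V" by (simp add: V_def)
  have box: "compact A" if "A \<in> V" for A
    using that assms(2) by (auto simp: box_chain_model_def closed_box_def V_def)
  have X: "X = \<Union>V" "julia_set p \<subseteq> X" "compact X"
    using assms(2) \<open>finite V\<close> box
    by (auto simp: box_chain_model_def X_def box_julia_set_def V_def intro!: compact_Union)
  have "\<exists>\<delta>>0. \<forall>A\<in>V. \<forall>B\<in>V. poly p ` A \<inter> nbhd B \<delta> \<noteq> {} \<longrightarrow> (A, B) \<in> parcs \<Gamma>"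
    using assms(2) by (simp add: box_chain_model_def V_def)
  then obtain \<delta> where "\<delta> > 0"
    and arc: "\<forall>A\<in>V. \<forall>B\<in>V. poly p ` A \<inter> nbhd B \<delta> \<noteq> {} \<longrightarrow> (A, B) \<in> parcs \<Gamma>"
    by blast
  have pos: "\<phi> A > 0" if "A \<in> V" for A
    using that assms(3) by (simp add: box_metric_def V_def)
  have expand: "\<phi> B * D z \<ge> L * \<phi> A" if "A \<in> V" "B \<in> V" "z \<in> A" "poly p z \<in> nbhd B \<delta>" for A B z
  proof -
    have "(A, B) \<in> parcs \<Gamma>"
      using arc that by blast
    \<comment> \<open>The derivative is multiplication by a complex number, so testing the vector 1
      captures the expansion in all directions.\<close>
    then have "box_norm \<phi> B (frechet_derivative (poly p) (at z) 1) \<ge> L * box_norm \<phi> A 1"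
      using assms(5) that(3) unfolding box_expansive_def by blast
    then show ?thesis
      by (simp add: box_norm_def frechet_derivative_poly D_def)
  qed
  \<comment> \<open>Inserting 1 keeps the set nonempty, so the extrema are meaningful and positive
    without a case split on \<open>V\<close>.\<close>
  define M where "M = Max (insert 1 (\<phi> ` V))"
  define m where "m = Min (insert 1 (\<phi> ` V))"
  have M: "M > 0" "\<And>A. A \<in> V \<Longrightarrow> \<phi> A \<le> M" and m: "m > 0" "\<And>A. A \<in> V \<Longrightarrow> m \<le> \<phi> A"
    using \<open>finite V\<close> pos by (auto simp: M_def m_def Max_gr_iff)
  \<comment> \<open>With radius \<delta>/2 the upper bounds hold on \<delta>/8-neighbourhoods, and
    the other \<delta>/2 is left for perturbing the image point.\<close>
  obtain \<rho> :: "complex \<Rightarrow> real" where smooth: "\<And>n. C_k n \<rho> UNIV"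
    and upper: "\<And>A z. A \<in> V \<Longrightarrow> z \<in> nbhd A (\<delta> / 8) \<Longrightarrow> \<rho> z \<le> \<phi> A"
    and lower: "\<And>z. M \<le> \<rho> z \<or> (\<exists>A\<in>V. z \<in> nbhd A (\<delta> / 2) \<and> \<phi> A \<le> \<rho> z)"
    using smooth_interpolation[where \<phi> = \<phi> and r = "\<delta> / 2", OF \<open>finite V\<close> box M(2)] \<open>\<delta> > 0\<close>
    by (simp flip: nbhd_def) blast
  have \<rho>_pos: "\<rho> z > 0" for z
    using lower[of z] M(1) pos by (meson less_le_trans)
  have near: "\<exists>B\<in>V. z \<in> nbhd B (\<delta> / 2) \<and> \<phi> B \<le> \<rho> z" if "z \<in> nbhd X (\<delta> / 8)" for z
  proof -
    obtain A where A: "A \<in> V" "z \<in> nbhd A (\<delta> / 8)"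
      using \<open>z \<in> _\<close> X(1) by (auto simp: nbhd_def)
    then have "z \<in> nbhd A (\<delta> / 2)"
      using \<open>\<delta> > 0\<close> by (force simp: nbhd_def)
    \<comment> \<open>If the alternative M \<le> \<rho> z occurs, then \<open>A\<close> itself
      serves as \<open>B\<close>, because \<phi> A \<le> M.\<close>
    then show ?thesis
      using lower[of z] A M(2)[of A] by fastforce
  qed
  have nbhd_self: "z \<in> nbhd S r" if "z \<in> S" "r > 0" for z S r
    using that by (auto simp: nbhd_def intro: bexI[of _ z])

  \<comment> \<open>Expansion by \<open>L\<close> on the box Julia set\<close>
  have "expands_on X (\<lambda>z v. \<rho> z * norm v) (poly p) L"
    unfolding expands_on_def
  proof (intro ballI impI allI)
    fix z v assume z: "z \<in> X" "poly p z \<in> X"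
    then obtain A where A: "A \<in> V" "z \<in> A"
      using X(1) by blast
    obtain B where B: "B \<in> V" "poly p z \<in> nbhd B (\<delta> / 2)" "\<phi> B \<le> \<rho> (poly p z)"
      using near nbhd_self[OF z(2)] \<open>\<delta> > 0\<close> by (metis zero_less_divide_iff zero_less_numeral)
    then have "poly p z \<in> nbhd B \<delta>"
      using \<open>\<delta> > 0\<close> by (force simp: nbhd_def)
    have "L * \<rho> z \<le> L * \<phi> A"
      using upper[OF A(1)] nbhd_self[OF A(2)] \<open>\<delta> > 0\<close> assms(4) by simp
    also have "\<dots> \<le> \<phi> B * D z"
      using expand A B \<open>poly p z \<in> nbhd B \<delta>\<close> by blast
    also have "\<dots> \<le> \<rho> (poly p z) * D z"
      using B(3) by (simp add: D_def mult_right_mono)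
    finally show "L * (\<rho> z * norm v) \<le> \<rho> (poly p z) * norm (frechet_derivative (poly p) (at z) v)"
      using mult_right_mono[of "L * \<rho> z" "\<rho> (poly p z) * D z" "norm v"]
      by (simp add: frechet_derivative_poly D_def norm_mult mult.assoc)
  qed

  \<comment> \<open>Expansion on a neighbourhood of the boxes\<close>
  moreover have "hyperbolic p"
  proof -
    define c where "c = (1 + L) / 2"
    have c: "c > 1" "c < L"
      using assms(4) by (simp_all add: c_def)
    \<comment> \<open>\<kappa> will bound |f'| from below at the relevant box points. It lets an
      additive error of \<kappa> (1 - c/L) in |f'| be absorbed as the factor c/L.\<close>
    define \<kappa> where "\<kappa> = L * m / M"
    have \<kappa>: "\<kappa> * (1 - c / L) > 0"
      using m(1) M(1) c by (simp add: \<kappa>_def)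
    \<comment> \<open>\<open>K\<close> is the closed 1-neighbourhood of \<open>X\<close>: a compact
      set containing both a nearby point and its base point, on which f and f' are uniformly
      continuous.\<close>
    define K where "K = {x + y |x y. x \<in> X \<and> y \<in> cball 0 1}"
    have "compact K"
      unfolding K_def using X(3) by (intro compact_sums) auto
    have in_K: "z \<in> K" if "x \<in> X" "dist x z \<le> 1" for x z
    proof -
      have "z = x + (z - x)" "z - x \<in> cball 0 1"
        using that by (auto simp: dist_norm norm_minus_commute)
      then show ?thesis
        unfolding K_def using that(1) by blast
    qed
    have unif: "uniformly_continuous_on K (poly q)" for q :: "complex poly"
      using \<open>compact K\<close> by (intro compact_uniformly_continuous continuous_intros)
    obtain d1 where d1: "d1 > 0"
      "\<And>x y. x \<in> K \<Longrightarrow> y \<in> K \<Longrightarrow> dist y x < d1 \<Longrightarrow> dist (poly p y) (poly p x) < \<delta> / 2"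
      using unif[of p] half_gt_zero[OF \<open>\<delta> > 0\<close>] unfolding uniformly_continuous_on_def by blast
    obtain d2 where d2: "d2 > 0" "\<And>x y. x \<in> K \<Longrightarrow> y \<in> K \<Longrightarrow> dist y x < d2 \<Longrightarrow>
        dist (poly (pderiv p) y) (poly (pderiv p) x) < \<kappa> * (1 - c / L)"
      using unif[of "pderiv p", unfolded uniformly_continuous_on_def, rule_format, OF \<kappa>] by metis
    \<comment> \<open>\<open>d1\<close> controls f, \<open>d2\<close> controls f', 1 keeps points in
      \<open>K\<close>, and \<delta>/8 keeps \<open>upper\<close> and \<open>near\<close>
      applicable.\<close>
    define \<eta> where "\<eta> = min (min d1 d2) (min 1 (\<delta> / 8))"
    have \<eta>: "\<eta> > 0" "\<eta> \<le> d1" "\<eta> \<le> d2" "\<eta> \<le> 1" "\<eta> \<le> \<delta> / 8"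
      using d1 d2 \<open>\<delta> > 0\<close> by (auto simp: \<eta>_def)
    define U where "U = nbhd X \<eta>"
    have "expands_on U (riemannian_norm (conformal_metric \<rho>)) (poly p) c"
      unfolding expands_on_def
    proof (intro ballI impI allI)
      fix z v :: complex assume z: "z \<in> U" "poly p z \<in> U"
      then obtain z' where z': "z' \<in> X" "dist z' z < \<eta>"
        by (auto simp: U_def nbhd_def)
      then obtain A where A: "A \<in> V" "z' \<in> A"
        using X(1) by blast
      have K: "z' \<in> K" "z \<in> K"
        using in_K[OF z'(1)] z'(2) \<eta>(4) by auto
      have "poly p z \<in> nbhd X (\<delta> / 8)"
        using z(2) \<eta>(5) by (force simp: U_def nbhd_def)
      then obtain B where B: "B \<in> V" "poly p z \<in> nbhd B (\<delta> / 2)" "\<phi> B \<le> \<rho> (poly p z)"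
        using near by blast
      then obtain w where w: "w \<in> B" "dist w (poly p z) < \<delta> / 2"
        by (auto simp: nbhd_def)
      \<comment> \<open>Box expansion is available only at points of boxes, so it is applied at z'.
        The box \<open>B\<close> chosen for f(z) is still within \<delta>/2 + \<delta>/2 of f(z'),
        which gives the edge from \<open>A\<close> to \<open>B\<close>.\<close>
      have "dist (poly p z) (poly p z') < \<delta> / 2"
        using d1(2)[OF K] z'(2) \<eta>(2) by (simp add: dist_commute)
      with w have "dist w (poly p z') < \<delta>"
        using dist_triangle[of w "poly p z'" "poly p z"] by simp
      with w have "poly p z' \<in> nbhd B \<delta>"
        by (auto simp: nbhd_def)
      with A B have ex: "L * \<phi> A \<le> \<phi> B * D z'"
        using expand by blast
      have "L * m \<le> L * \<phi> A"
        using m(2)[OF A(1)] assms(4) by simp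
      also note ex
      also have "\<phi> B * D z' \<le> M * D z'"
        using M(2)[OF B(1)] by (simp add: D_def mult_right_mono)
      finally have "\<kappa> \<le> D z'"
        using M(1) by (simp add: \<kappa>_def field_simps)
      then have "\<kappa> * (1 - c / L) \<le> D z' * (1 - c / L)"
        using c by (intro mult_right_mono) (auto simp: field_simps)
      moreover have "D z' - D z \<le> \<kappa> * (1 - c / L)"
        using d2(2)[OF K] z'(2) \<eta>(3) norm_triangle_ineq2[of "poly (pderiv p) z'" "poly (pderiv p) z"]
        by (simp add: D_def dist_norm norm_minus_commute)
      \<comment> \<open>The loss in passing from z' to z is at most the fraction 1 - c/L of
        \<open>D z'\<close>, leaving the fraction c/L.\<close>
      ultimately have Dz: "D z' * (c / L) \<le> D z"
        by (simp add: algebra_simps)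
      have "z \<in> nbhd A (\<delta> / 8)"
        using z'(2) A(2) \<eta>(5) by (force simp: nbhd_def)
      then have "c * \<rho> z \<le> c / L * (L * \<phi> A)"
        using upper[OF A(1)] c by simp
      also have "\<dots> \<le> c / L * (\<phi> B * D z')"
        using ex c by (intro mult_left_mono) auto
      also have "\<dots> = \<phi> B * (D z' * (c / L))"
        by simp
      also have "\<dots> \<le> \<rho> (poly p z) * D z"
        using Dz B(3) \<rho>_pos[of "poly p z"] c by (intro mult_mono) (auto simp: D_def)
      finally have "c * \<rho> z * norm v \<le> \<rho> (poly p z) * D z * norm v"
        by (simp add: mult_right_mono)
      then show "c * riemannian_norm (conformal_metric \<rho>) z v \<le>
          riemannian_norm (conformal_metric \<rho>) (poly p z) (frechet_derivative (poly p) (at z) v)"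
        by (simp add: riemannian_norm_conformal_metric[OF less_imp_le[OF \<rho>_pos]]
            frechet_derivative_poly D_def norm_mult mult.assoc)
    qed
    moreover have "open U" "julia_set p \<subseteq> U"
      using X(2) nbhd_self[of _ X \<eta>] \<eta>(1) by (auto simp: U_def nbhd_def)
    ultimately show ?thesis
      unfolding hyperbolic_def
      using c(1) riemannian_metric_on_conformal[OF smooth \<rho>_pos] by blast
  qed
  ultimately show ?thesis
    using smooth_onI[OF smooth] \<rho>_pos riemannian_metric_on_conformal[OF smooth \<rho>_pos]
    unfolding X_def by blast
qed

end
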